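(* Let $n\ge 5$, let $B$ be a $3$-by-$3$ reciprocal matrix, and let $$A=\begin{bmatrix} B & J_{3,n-3}\\ J_{n-3,3} & J_{n-3}\end{bmatrix}.$$ Then $$\mathcal{E}(A)=\bigcup_{i=4}^{n}\mathcal{E}(A;i).$$
   Context: An $n$-by-$n$ entrywise positive matrix $A=[a_{ij}]$ is reciprocal if $a_{ji}=1/a_{ij}$ for all $i,j$. $J_{m,k}$ denotes the $m$-by-$k$ all-ones matrix, $J_m=J_{m,m}$. A vector $w$ with positive entries is efficient for a reciprocal matrix $A$ if, for every positive vector $v$, the entrywise inequality $\left|A-[v_i/v_j]\right|\le\left|A-[w_i/w_j]\right|$ implies $v=w$; $\mathcal{E}(A)$ denotes the set of efficient vectors for $A$. For $i\in\{1,\ldots,n\}$, $A(i)$ is the principal submatrix obtained by deleting row and column $i$, $w(i)$ is the vector obtained by deleting entry $i$, and $\mathcal{E}(A;i)=\{w\in\mathcal{E}(A): w(i)\in\mathcal{E}(A(i))\}$.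
   Formalization: Efficiency is taken up to positive scaling: the inequality must imply v = c·w for some c > 0, since with literal v = w the vector v = 2w shows that no vector would be efficient. *)

theory Defs
  imports Jordan_Normal_Form.Determinant
begin

definition reciprocal_mat :: "real mat \<Rightarrow> bool" where
  "reciprocal_mat A \<longleftrightarrow> square_mat A \<and>
     (\<forall>i < dim_row A. \<forall>j < dim_row A. 0 < A $$ (i, j) \<and> A $$ (j, i) = 1 / A $$ (i, j))"

definition ones_mat :: "nat \<Rightarrow> nat \<Rightarrow> real mat" where
  "ones_mat m k = mat m k (\<lambda>_. 1)"

definition positive_vec :: "real vec \<Rightarrow> bool" where
  "positive_vec w \<longleftrightarrow> (\<forall>i < dim_vec w. 0 < w $ i)"

definition vec_delete :: "'a vec \<Rightarrow> nat \<Rightarrow> 'a vec" where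
  "vec_delete w i = vec (dim_vec w - 1) (\<lambda>k. w $ (if k < i then k else Suc k))"

text \<open>The matrix of ratios of \<open>v\<close> does not change when \<open>v\<close> is scaled, so uniqueness of an efficient
  vector is meant up to a positive factor (literal equality would make no vector efficient).\<close>

definition efficient :: "real mat \<Rightarrow> real vec \<Rightarrow> bool" where
  "efficient A w \<longleftrightarrow> w \<in> carrier_vec (dim_row A) \<and> positive_vec w \<and>
     (\<forall>v \<in> carrier_vec (dim_row A). positive_vec v \<longrightarrow>
        (\<forall>i < dim_row A. \<forall>j < dim_row A.
           \<bar>A $$ (i, j) - v $ i / v $ j\<bar> \<le> \<bar>A $$ (i, j) - w $ i / w $ j\<bar>) \<longrightarrow>
        (\<exists>c > 0. v = c \<cdot>\<^sub>v w))"

definition efficient_vecs :: "real mat \<Rightarrow> real vec set" where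
  "efficient_vecs A = {w. efficient A w}"

definition efficient_vecs_at :: "real mat \<Rightarrow> nat \<Rightarrow> real vec set" where
  "efficient_vecs_at A i =
     {w \<in> efficient_vecs A. vec_delete w i \<in> efficient_vecs (mat_delete A i i)}"

end

theory Submission
  imports Defs
begin

text \<open>
  Draw an arc from \<open>i\<close> to \<open>j\<close> when \<open>w\<^sub>i / w\<^sub>j \<ge> a\<^sub>i\<^sub>j\<close>. A vector \<open>w\<close> is efficient iff this digraph is
  strongly connected: if a nonempty proper set \<open>S\<close> has no outgoing arc, slightly scaling \<open>w\<close> up on \<open>S\<close>
  improves the approximation; conversely, if \<open>v\<close> approximates at least as well as \<open>w\<close>, then
  \<open>v\<^sub>i / w\<^sub>i\<close> is nondecreasing along arcs, hence constant.

  Deleting a vertex from the digraph leaves the digraph of the smaller matrix and vector. For the block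
  matrix, arcs outside the \<open>3\<times>3\<close> block just compare entries of \<open>w\<close>. If at least three indices lie
  outside the block, any one that carries neither the largest nor the smallest of their entries can be
  deleted keeping strong connectivity; if only two do, one of them can. An obstruction would require
  four distinct vertices inside the block.
\<close>

section \<open>Strong connectivity\<close>

definition strongly_connected_on :: "'a set \<Rightarrow> 'a rel \<Rightarrow> bool" where
  "strongly_connected_on V r \<longleftrightarrow> (\<forall>x\<in>V. \<forall>y\<in>V. (x, y) \<in> (Restr r V)\<^sup>*)"

definition absorbing :: "'a set \<Rightarrow> 'a rel \<Rightarrow> 'a set \<Rightarrow> bool" where
  "absorbing V r S \<longleftrightarrow> S \<subset> V \<and> S \<noteq> {} \<and> (\<forall>i\<in>S. \<forall>j\<in>V - S. (i, j) \<notin> r)"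

lemma strongly_connected_on_iff_no_absorbing:
  "strongly_connected_on V r \<longleftrightarrow> (\<nexists>S. absorbing V r S)"
proof (intro iffI notI)
  assume conn: "strongly_connected_on V r" and "\<exists>S. absorbing V r S"
  then obtain S x y where S: "absorbing V r S" and xy: "x \<in> S" "y \<in> V - S"
    unfolding absorbing_def by blast
  have "Restr r V `` S \<subseteq> S" using S unfolding absorbing_def by blast
  then have "(Restr r V)\<^sup>* `` S = S" by (rule Image_closed_trancl)
  moreover have "(x, y) \<in> (Restr r V)\<^sup>*"
    using conn S xy unfolding strongly_connected_on_def absorbing_def by blast
  ultimately show False using xy by blast
next
  assume none: "\<nexists>S. absorbing V r S"
  show "strongly_connected_on V r"
    unfolding strongly_connected_on_def
  proof (intro ballI)
    fix x y assume xy: "x \<in> V" "y \<in> V"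
    let ?S = "(Restr r V)\<^sup>* `` {x}"
    have sub: "?S \<subseteq> V" using xy(1) by (auto elim: rtranclE)
    have "(i, j) \<notin> r" if "i \<in> ?S" "j \<in> V - ?S" for i j
      using that sub by (auto intro: rtrancl_into_rtrancl)
    moreover have "x \<in> ?S" by simp
    ultimately have "?S = V" using none sub unfolding absorbing_def by blast
    then show "(x, y) \<in> (Restr r V)\<^sup>*" using xy(2) by blast
  qed
qed

lemma strongly_connected_on_exit:
  assumes "strongly_connected_on V r" "S \<subseteq> V" "a \<in> S" "b \<in> V - S"
  obtains i j where "i \<in> S" "j \<in> V - S" "(i, j) \<in> r"
proof -
  have "S \<subset> V" "S \<noteq> {}" using assms by auto
  with assms(1) that show thesis
    unfolding strongly_connected_on_iff_no_absorbing absorbing_def by blast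
qed

lemma strongly_connected_on_mono_imp_const:
  fixes f :: "'a \<Rightarrow> 'b :: order"
  assumes conn: "strongly_connected_on V r"
    and mono: "\<And>i j. i \<in> V \<Longrightarrow> j \<in> V \<Longrightarrow> (i, j) \<in> r \<Longrightarrow> f i \<le> f j"
    and xy: "x \<in> V" "y \<in> V"
  shows "f x = f y"
proof -
  have "f a \<le> f b" if "(a, b) \<in> (Restr r V)\<^sup>*" for a b
    using that by induction (auto intro: order_trans mono)
  then show ?thesis
    using conn xy unfolding strongly_connected_on_def by (blast intro: order_antisym)
qed

lemma absorbing_inv_image:
  assumes "inj_on f V" "S \<subseteq> V"
  shows "absorbing V (inv_image r f) S \<longleftrightarrow> absorbing (f ` V) r (f ` S)"
proof -
  have "f ` V - f ` S = f ` (V - S)" using inj_on_image_set_diff[OF assms(1), of V S] assms(2) by simp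
  moreover have "f ` S \<subset> f ` V \<longleftrightarrow> S \<subset> V"
    using inj_on_image_eq_iff[OF assms(1), of S V] assms(2) by blast
  ultimately show ?thesis unfolding absorbing_def by simp
qed

lemma strongly_connected_on_inv_image:
  assumes "inj_on f V"
  shows "strongly_connected_on V (inv_image r f) \<longleftrightarrow> strongly_connected_on (f ` V) r"
proof -
  have "(\<exists>S. absorbing V (inv_image r f) S) \<longleftrightarrow> (\<exists>S\<subseteq>V. absorbing V (inv_image r f) S)"
    unfolding absorbing_def by blast
  also have "\<dots> \<longleftrightarrow> (\<exists>S\<subseteq>V. absorbing (f ` V) r (f ` S))"
    using absorbing_inv_image[OF assms] by blast
  also have "\<dots> \<longleftrightarrow> (\<exists>T\<subseteq>f ` V. absorbing (f ` V) r T)"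
    unfolding subset_image_iff by blast
  also have "\<dots> \<longleftrightarrow> (\<exists>T. absorbing (f ` V) r T)" unfolding absorbing_def by blast
  finally show ?thesis unfolding strongly_connected_on_iff_no_absorbing by simp
qed

lemma absorbing_delete_vertexE:
  assumes "strongly_connected_on V r" "m \<in> V" "absorbing (V - {m}) r S"
  obtains x y where "x \<in> S" "y \<in> V - {m} - S" "(x, m) \<in> r" "(m, y) \<in> r"
proof -
  have no_arc: "(i, j) \<notin> r" if "i \<in> S" "j \<in> V - {m} - S" for i j
    using assms(3) that unfolding absorbing_def by blast
  obtain a c where S: "S \<subseteq> V" "m \<notin> S" "a \<in> S" "c \<in> V - {m} - S"
    using assms(3) unfolding absorbing_def by blast
  obtain x j where x: "x \<in> S" "j \<in> V - S" "(x, j) \<in> r"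
    using strongly_connected_on_exit[OF assms(1), of S a c] S by blast
  then have "j = m" using no_arc[of x j] by blast
  obtain i y where y: "i \<in> insert m S" "y \<in> V - insert m S" "(i, y) \<in> r"
    using strongly_connected_on_exit[OF assms(1), of "insert m S" a c] S assms(2) by blast
  then have "i = m" using no_arc[of i y] by blast
  show thesis using that[of x y] x y \<open>j = m\<close> \<open>i = m\<close> by blast
qed


section \<open>Digraphs that compare vertices outside a small set\<close>

locale comparison_digraph =
  fixes P K :: "'a set" and r :: "'a rel" and w :: "'a \<Rightarrow> 'b :: linorder"
  assumes finite_P: "finite P" and card_P: "card P \<le> 3"
    and disjoint: "P \<inter> K = {}"
    and arc_iff: "\<And>i j. i \<in> P \<union> K \<Longrightarrow> j \<in> P \<union> K \<Longrightarrow> i \<in> K \<or> j \<in> K \<Longrightarrow>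
      (i, j) \<in> r \<longleftrightarrow> w j \<le> w i"
    and semicomplete: "\<And>i j. i \<in> P \<Longrightarrow> j \<in> P \<Longrightarrow> (i, j) \<in> r \<or> (j, i) \<in> r"
    and connected: "strongly_connected_on (P \<union> K) r"
begin

lemma not_distinct_four_in_P:
  assumes "{a, b, c, d} \<subseteq> P"
  shows "\<not> distinct [a, b, c, d]"
proof
  assume "distinct [a, b, c, d]"
  then have "card {a, b, c, d} = 4" by simp
  then show False using card_mono[OF finite_P assms] card_P by simp
qed

lemma less_across_absorbing:
  assumes "absorbing U r S" "U \<subseteq> P \<union> K" "i \<in> S" "j \<in> U - S" "i \<in> K \<or> j \<in> K"
  shows "w i < w j"
proof -
  have "(i, j) \<notin> r" "i \<in> P \<union> K" "j \<in> P \<union> K" using assms(1-4) unfolding absorbing_def by blast+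
  then show ?thesis using arc_iff[of i j] assms(5) by (simp add: not_le)
qed

lemma undeletable_vertexE:
  assumes "m \<in> K" "\<not> strongly_connected_on (P \<union> K - {m}) r"
  obtains S x y where "absorbing (P \<union> K - {m}) r S" "x \<in> P \<inter> S" "y \<in> P - S"
    "w m \<le> w x" "w y \<le> w m"
proof -
  obtain S where S: "absorbing (P \<union> K - {m}) r S"
    using assms(2) unfolding strongly_connected_on_iff_no_absorbing by blast
  obtain x y where xy: "x \<in> S" "y \<in> P \<union> K - {m} - S" "(x, m) \<in> r" "(m, y) \<in> r"
    using absorbing_delete_vertexE[OF connected _ S] assms(1) by blast
  have "x \<in> P \<union> K" using S xy(1) unfolding absorbing_def by blast
  then have w: "w m \<le> w x" "w y \<le> w m"
    using xy assms(1) arc_iff[of x m] arc_iff[of m y] by auto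
  then have "x \<notin> K" "y \<notin> K"
    using less_across_absorbing[OF S Diff_subset xy(1,2)] by auto
  then show thesis using that[OF S _ _ w] xy \<open>x \<in> P \<union> K\<close> by blast
qed

lemma down_set_splits_P:
  assumes "U \<subseteq> P \<union> K" "a \<in> U" "b \<in> P \<union> K - U"
    and down: "\<And>i j. i \<in> U \<Longrightarrow> j \<in> P \<union> K - U \<Longrightarrow> w i < w j"
  obtains i j where "i \<in> P \<inter> U" "j \<in> P - U"
proof -
  obtain i j where ij: "i \<in> U" "j \<in> P \<union> K - U" "(i, j) \<in> r"
    by (rule strongly_connected_on_exit[OF connected assms(1-3)])
  then have "i \<notin> K" "j \<notin> K"
    using arc_iff[of i j] down[OF ij(1,2)] assms(1) by auto
  then show thesis using that ij assms(1) by blast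
qed

lemma delete_intermediate:
  assumes K: "upper \<in> K" "lower \<in> K" "m \<in> K - {upper, lower}"
    and upper: "w m \<le> w upper" and lower: "w lower \<le> w m"
  shows "strongly_connected_on (P \<union> K - {m}) r"
proof (rule ccontr)
  assume undeletable: "\<not> ?thesis"
  have "m \<in> K" using K(3) by simp
  obtain S x y where S: "absorbing (P \<union> K - {m}) r S"
    and xy: "x \<in> P \<inter> S" "y \<in> P - S" and w: "w m \<le> w x" "w y \<le> w m"
    by (rule undeletable_vertexE[OF \<open>m \<in> K\<close> undeletable])
  note less = less_across_absorbing[OF S Diff_subset]
  have "lower \<in> S" using less[of x lower] K xy lower w by fastforce
  have "upper \<notin> S" using less[of upper y] K xy disjoint upper w by fastforce
  have x: "w x < w upper" and y: "w lower < w y"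
    using less[of x upper] less[of lower y] \<open>lower \<in> S\<close> \<open>upper \<notin> S\<close> xy K disjoint by auto
  let ?below = "{i \<in> P \<union> K. w i < w upper}" and ?lowest = "{i \<in> P \<union> K. w i \<le> w lower}"
  obtain high where high: "high \<in> P" "w upper \<le> w high"
    by (rule down_set_splits_P[of ?below x upper]) (use x xy K in auto)
  obtain low where low: "low \<in> P" "w low \<le> w lower"
    by (rule down_set_splits_P[of ?lowest lower y]) (use y xy K in auto)
  have "w low < w y" "w y \<le> w x" "w x < w high" using low high x y w by auto
  then have "distinct [low, y, x, high]" using xy by auto
  then show False using not_distinct_four_in_P[of low y x high] xy low high by blast
qed

lemma delete_one_of_two:
  assumes K: "K = {a, b}" "a \<noteq> b" and "w b \<le> w a"
  shows "strongly_connected_on (P \<union> K - {a}) r \<or> strongly_connected_on (P \<union> K - {b}) r"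
proof (rule ccontr)
  assume "\<not> ?thesis"
  then have undeletable: "\<not> strongly_connected_on (P \<union> K - {a}) r"
    "\<not> strongly_connected_on (P \<union> K - {b}) r" by auto
  have "a \<in> K" "b \<in> K" using K by auto
  obtain S x y where S: "absorbing (P \<union> K - {a}) r S"
    and xy: "x \<in> P \<inter> S" "y \<in> P - S" and w: "w a \<le> w x" "w y \<le> w a"
    by (rule undeletable_vertexE[OF \<open>a \<in> K\<close> undeletable(1)])
  obtain S' x' y' where S': "absorbing (P \<union> K - {b}) r S'"
    and xy': "x' \<in> P \<inter> S'" "y' \<in> P - S'" and w': "w b \<le> w x'" "w y' \<le> w b"
    by (rule undeletable_vertexE[OF \<open>b \<in> K\<close> undeletable(2)])
  note less = less_across_absorbing[OF S Diff_subset]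
    and less' = less_across_absorbing[OF S' Diff_subset]
  have notP: "a \<notin> P" "b \<notin> P" using K disjoint by auto
  have "b \<in> S" using less[of x b] K xy w \<open>w b \<le> w a\<close> by fastforce
  then have y: "w b < w y" using less[of b y] K xy notP by auto
  have "a \<notin> S'" using less'[of a y'] K xy' notP w' \<open>w b \<le> w a\<close> by fastforce
  then have x': "w x' < w a" using less'[of x' a] K xy' notP by auto
  have "y' \<in> S" using less[of b y'] \<open>b \<in> S\<close> K xy' notP w' by fastforce
  have "w y' < w y" "w y \<le> w x" "w x' < w x" using y x' w w' by auto
  then have "distinct [y', y, x]" "x' \<noteq> x" "x' \<noteq> y'" using xy xy' by auto
  then have "x' = y" using not_distinct_four_in_P[of y' y x x'] xy xy' by auto
  then have "(y, y') \<notin> r" "(y', y) \<notin> r"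
    using S S' xy xy' notP \<open>y' \<in> S\<close> unfolding absorbing_def by blast+
  then show False using semicomplete[of y y'] xy xy' by blast
qed

lemma exists_deletable_vertex:
  assumes "2 \<le> card K"
  shows "\<exists>m\<in>K. strongly_connected_on (P \<union> K - {m}) r"
proof -
  have fin: "finite (w ` K)" and ne: "w ` K \<noteq> {}" using assms card.infinite by fastforce+
  obtain upper where upper: "upper \<in> K" "w upper = Max (w ` K)"
    using Max_in[OF fin ne] by force
  obtain lower where lower: "lower \<in> K" "w lower = Min (w ` K)"
    using Min_in[OF fin ne] by force
  have extremal: "w k \<le> w upper" "w lower \<le> w k" if "k \<in> K" for k
    using that upper lower fin by simp_all
  show ?thesis
  proof (cases "K \<subseteq> {upper, lower}")
    case True
    then have K: "K = {upper, lower}" using upper lower by blast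
    then have "upper \<noteq> lower" using assms by auto
    then show ?thesis using delete_one_of_two[OF K] extremal K by blast
  next
    case False
    then obtain m where "m \<in> K - {upper, lower}" by blast
    then show ?thesis using delete_intermediate[of upper lower m] upper lower extremal by blast
  qed
qed

end


section \<open>Efficiency as strong connectivity\<close>

lemma reciprocal_matD:
  assumes "reciprocal_mat A" "i < dim_row A" "j < dim_row A"
  shows "0 < A $$ (i, j)" "A $$ (j, i) = 1 / A $$ (i, j)"
  using assms unfolding reciprocal_mat_def by blast+

lemma positive_vecD: "positive_vec w \<Longrightarrow> i < dim_vec w \<Longrightarrow> 0 < w $ i"
  unfolding positive_vec_def by blast

definition ratio_digraph :: "real mat \<Rightarrow> real vec \<Rightarrow> nat rel" where
  "ratio_digraph A w = {(i, j). i < dim_row A \<and> j < dim_row A \<and> A $$ (i, j) \<le> w $ i / w $ j}"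

lemma ratio_digraph_semicomplete:
  assumes A: "reciprocal_mat A" and w: "w \<in> carrier_vec (dim_row A)" "positive_vec w"
    and ij: "i < dim_row A" "j < dim_row A"
  shows "(i, j) \<in> ratio_digraph A w \<or> (j, i) \<in> ratio_digraph A w"
proof (cases "A $$ (i, j) \<le> w $ i / w $ j")
  case True
  then show ?thesis using ij unfolding ratio_digraph_def by simp
next
  case False
  have "0 < w $ i / w $ j" using ij w by (simp add: positive_vecD)
  then have "1 / A $$ (i, j) \<le> 1 / (w $ i / w $ j)" using False by (intro frac_le) auto
  then have "A $$ (j, i) \<le> w $ j / w $ i" using reciprocal_matD(2)[OF A ij] by simp
  then show ?thesis using ij unfolding ratio_digraph_def by simp
qed

definition approximates_as_well :: "real mat \<Rightarrow> real vec \<Rightarrow> real vec \<Rightarrow> bool" where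
  "approximates_as_well A v w \<longleftrightarrow> (\<forall>i < dim_row A. \<forall>j < dim_row A.
     \<bar>A $$ (i, j) - v $ i / v $ j\<bar> \<le> \<bar>A $$ (i, j) - w $ i / w $ j\<bar>)"

lemma efficient_iff_approximates_as_well:
  "efficient A w \<longleftrightarrow> w \<in> carrier_vec (dim_row A) \<and> positive_vec w \<and>
     (\<forall>v \<in> carrier_vec (dim_row A). positive_vec v \<longrightarrow> approximates_as_well A v w \<longrightarrow>
        (\<exists>c > 0. v = c \<cdot>\<^sub>v w))"
  unfolding efficient_def approximates_as_well_def ..

lemma ratio_mono_along_arc:
  assumes "approximates_as_well A v w" "(i, j) \<in> ratio_digraph A w"
    and "0 < v $ i" "0 < v $ j" "0 < w $ i" "0 < w $ j"
  shows "v $ i / w $ i \<le> v $ j / w $ j"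
proof -
  have "\<bar>A $$ (i, j) - v $ i / v $ j\<bar> \<le> w $ i / w $ j - A $$ (i, j)"
    using assms(1,2) unfolding approximates_as_well_def ratio_digraph_def by fastforce
  then have "v $ i / v $ j \<le> w $ i / w $ j" by linarith
  then show ?thesis using assms(3-6) by (simp add: field_simps)
qed

lemma strongly_connected_imp_efficient:
  assumes w: "w \<in> carrier_vec (dim_row A)" "positive_vec w"
    and conn: "strongly_connected_on {..<dim_row A} (ratio_digraph A w)"
  shows "efficient A w"
  unfolding efficient_iff_approximates_as_well
proof (intro conjI ballI impI w)
  let ?n = "dim_row A"
  fix v assume v: "v \<in> carrier_vec ?n" "positive_vec v" and vw: "approximates_as_well A v w"
  have pos: "0 < v $ i" "0 < w $ i" if "i < ?n" for i
    using that v w by (auto intro: positive_vecD)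
  have const: "v $ i / w $ i = v $ j / w $ j" if "i < ?n" "j < ?n" for i j
    by (rule strongly_connected_on_mono_imp_const[OF conn])
      (use that pos in \<open>auto intro: ratio_mono_along_arc[OF vw]\<close>)
  show "\<exists>c > 0. v = c \<cdot>\<^sub>v w"
  proof (cases "?n = 0")
    case True
    then show ?thesis using v w by (intro exI[of _ 1]) auto
  next
    case False
    let ?c = "v $ 0 / w $ 0"
    have "v = ?c \<cdot>\<^sub>v w"
    proof (rule eq_vecI)
      fix i assume "i < dim_vec (?c \<cdot>\<^sub>v w)"
      then have "i < ?n" using w by simp
      then show "v $ i = (?c \<cdot>\<^sub>v w) $ i"
        using const[of 0 i] pos(2)[of i] w by (simp add: eq_divide_eq)
    qed (use v w in simp)
    then show ?thesis using pos[of 0] False by (intro exI[of _ ?c]) simp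
  qed
qed

lemma exists_common_enlargement:
  fixes f g :: "'a \<Rightarrow> 'b :: linordered_field"
  assumes "finite X" "\<And>x. x \<in> X \<Longrightarrow> 0 < f x \<and> f x < g x"
  shows "\<exists>c>1. \<forall>x\<in>X. c * f x \<le> g x"
proof (intro exI conjI ballI)
  let ?c = "Min (insert 2 ((\<lambda>x. g x / f x) ` X))"
  show "1 < ?c" using assms by (auto simp: less_divide_eq)
  show "?c * f x \<le> g x" if "x \<in> X" for x
  proof -
    have "?c \<le> g x / f x" using assms(1) that by (intro Min_le) auto
    then show ?thesis using assms(2)[OF that] by (simp add: le_divide_eq)
  qed
qed

definition scale_on :: "nat set \<Rightarrow> real \<Rightarrow> real vec \<Rightarrow> real vec" where
  "scale_on S c w = vec (dim_vec w) (\<lambda>i. if i \<in> S then c * w $ i else w $ i)"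

lemma dim_scale_on [simp]: "dim_vec (scale_on S c w) = dim_vec w"
  unfolding scale_on_def by simp

lemma index_scale_on [simp]:
  "i < dim_vec w \<Longrightarrow> scale_on S c w $ i = (if i \<in> S then c * w $ i else w $ i)"
  unfolding scale_on_def by simp

lemma positive_scale_on: "positive_vec w \<Longrightarrow> 0 < c \<Longrightarrow> positive_vec (scale_on S c w)"
  unfolding positive_vec_def by simp

lemma approximates_as_well_scale_on:
  assumes A: "reciprocal_mat A" and w: "w \<in> carrier_vec (dim_row A)" "positive_vec w"
    and "1 \<le> c"
    and enlarge: "\<And>i j. i < dim_row A \<Longrightarrow> j < dim_row A \<Longrightarrow> i \<in> S \<Longrightarrow> j \<notin> S \<Longrightarrow>
      c * (w $ i / w $ j) \<le> A $$ (i, j)"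
  shows "approximates_as_well A (scale_on S c w) w"
  unfolding approximates_as_well_def
proof (intro allI impI)
  fix i j assume ij: "i < dim_row A" "j < dim_row A"
  let ?v = "scale_on S c w"
  have pos: "0 < w $ i" "0 < w $ j" using ij w by (auto intro: positive_vecD)
  consider (same) "i \<in> S \<longleftrightarrow> j \<in> S" | (leaving) "i \<in> S" "j \<notin> S" | (entering) "i \<notin> S" "j \<in> S" by blast
  then show "\<bar>A $$ (i, j) - ?v $ i / ?v $ j\<bar> \<le> \<bar>A $$ (i, j) - w $ i / w $ j\<bar>"
  proof cases
    case same
    then show ?thesis using ij w \<open>1 \<le> c\<close> by auto
  next
    case leaving
    then have "?v $ i / ?v $ j = c * (w $ i / w $ j)" using ij w by simp
    moreover have "w $ i / w $ j \<le> c * (w $ i / w $ j)" using pos \<open>1 \<le> c\<close> by (simp add: divide_right_mono)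
    ultimately show ?thesis using enlarge[OF ij leaving] by linarith
  next
    case entering
    then have "?v $ i / ?v $ j = w $ i / w $ j / c" using ij w by simp
    moreover have "w $ i / w $ j / c \<le> w $ i / w $ j" using pos \<open>1 \<le> c\<close> by (simp add: divide_le_eq)
    moreover have "A $$ (i, j) \<le> w $ i / w $ j / c"
      using enlarge[OF ij(2,1) entering(2,1)] reciprocal_matD(1)[OF A ij(2,1)] pos \<open>1 \<le> c\<close>
      by (simp add: reciprocal_matD(2)[OF A ij(2,1)] field_simps)
    ultimately show ?thesis by linarith
  qed
qed

lemma efficient_imp_strongly_connected:
  assumes A: "reciprocal_mat A" and eff: "efficient A w"
  shows "strongly_connected_on {..<dim_row A} (ratio_digraph A w)"
  unfolding strongly_connected_on_iff_no_absorbing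
proof
  let ?n = "dim_row A"
  assume "\<exists>S. absorbing {..<?n} (ratio_digraph A w) S"
  then obtain S a b where S: "absorbing {..<?n} (ratio_digraph A w) S"
    and ab: "a \<in> S" "b \<notin> S" "a < ?n" "b < ?n"
    unfolding absorbing_def by blast
  have w: "w \<in> carrier_vec ?n" "positive_vec w" using eff unfolding efficient_def by auto
  have pos: "0 < w $ i" if "i < ?n" for i using that w by (auto intro: positive_vecD)
  let ?X = "{(i, j). i < ?n \<and> j < ?n \<and> i \<in> S \<and> j \<notin> S}"
  have "finite ?X" by (rule finite_subset[of _ "{..<?n} \<times> {..<?n}"]) auto
  moreover have "0 < w $ i / w $ j \<and> w $ i / w $ j < A $$ (i, j)" if "(i, j) \<in> ?X" for i j
    using that S pos[of i] pos[of j] unfolding absorbing_def ratio_digraph_def by force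
  ultimately obtain c where c: "c > 1"
    and enlarge: "\<And>i j. (i, j) \<in> ?X \<Longrightarrow> c * (w $ i / w $ j) \<le> A $$ (i, j)"
    using exists_common_enlargement[of ?X "\<lambda>(i, j). w $ i / w $ j" "\<lambda>(i, j). A $$ (i, j)"]
    by fastforce
  let ?v = "scale_on S c w"
  have "?v \<in> carrier_vec ?n" "positive_vec ?v" using w c by (auto intro: positive_scale_on carrier_vecI)
  moreover have "approximates_as_well A ?v w"
    by (rule approximates_as_well_scale_on[OF A w]) (use c enlarge in auto)
  ultimately obtain d where "?v = d \<cdot>\<^sub>v w"
    using eff unfolding efficient_iff_approximates_as_well by blast
  then have "?v $ i = d * w $ i" if "i < ?n" for i using that w by simp
  from this[OF ab(3)] this[OF ab(4)] have "c * w $ a = d * w $ a" "w $ b = d * w $ b"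
    using ab w by simp_all
  then show False using pos[OF ab(3)] pos[OF ab(4)] c by simp
qed

lemma efficient_iff_strongly_connected:
  assumes "reciprocal_mat A" "w \<in> carrier_vec (dim_row A)" "positive_vec w"
  shows "efficient A w \<longleftrightarrow> strongly_connected_on {..<dim_row A} (ratio_digraph A w)"
  using assms efficient_imp_strongly_connected strongly_connected_imp_efficient by blast


section \<open>Deleting an index\<close>

lemma mat_delete_diag_index:
  assumes "square_mat A" "m < dim_row A" "i < dim_row A - 1" "j < dim_row A - 1"
  shows "mat_delete A m m $$ (i, j) = A $$ (insert_index m i, insert_index m j)"
proof -
  have "Suc (dim_row A - 1) = dim_row A" using assms(2) by simp
  then have "A \<in> carrier_mat (Suc (dim_row A - 1)) (Suc (dim_row A - 1))"
    using assms(1) by (intro carrier_matI) simp_all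
  from mat_delete_index[OF this, of m m i j] show ?thesis using assms by simp
qed

lemma insert_index_less_iff: "m < n \<Longrightarrow> insert_index m i < n \<longleftrightarrow> i < n - 1"
  by (auto simp: insert_index_def)

lemma reciprocal_mat_delete:
  assumes A: "reciprocal_mat A" and m: "m < dim_row A"
  shows "reciprocal_mat (mat_delete A m m)"
proof -
  have square: "square_mat A" using A unfolding reciprocal_mat_def by blast
  show ?thesis
    unfolding reciprocal_mat_def
  proof (intro conjI allI impI)
    show "square_mat (mat_delete A m m)" using square by simp
    fix i j assume "i < dim_row (mat_delete A m m)" "j < dim_row (mat_delete A m m)"
    then have ij: "i < dim_row A - 1" "j < dim_row A - 1" by simp_all
    then have "insert_index m i < dim_row A" "insert_index m j < dim_row A"
      using insert_index_less_iff[OF m] by simp_all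
    from reciprocal_matD[OF A this]
    show "0 < mat_delete A m m $$ (i, j)" "mat_delete A m m $$ (j, i) = 1 / mat_delete A m m $$ (i, j)"
      using mat_delete_diag_index[OF square m] ij by simp_all
  qed
qed

lemma dim_vec_delete [simp]: "dim_vec (vec_delete w m) = dim_vec w - 1"
  unfolding vec_delete_def by simp

lemma index_vec_delete:
  "i < dim_vec w - 1 \<Longrightarrow> vec_delete w m $ i = w $ insert_index m i"
  unfolding vec_delete_def insert_index_def by simp

lemma positive_vec_delete:
  "positive_vec w \<Longrightarrow> m < dim_vec w \<Longrightarrow> positive_vec (vec_delete w m)"
  unfolding positive_vec_def by (simp add: index_vec_delete insert_index_less_iff)

lemma ratio_digraph_delete:
  assumes "square_mat A" "w \<in> carrier_vec (dim_row A)" "m < dim_row A"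
  shows "ratio_digraph (mat_delete A m m) (vec_delete w m)
    = inv_image (ratio_digraph A w) (insert_index m)"
proof -
  have "i < dim_row A - 1 \<Longrightarrow> vec_delete w m $ i = w $ insert_index m i" for i
    using assms(2) by (simp add: index_vec_delete)
  then show ?thesis
    unfolding ratio_digraph_def inv_image_def
    using assms by (auto simp: mat_delete_diag_index insert_index_less_iff)
qed

lemma efficient_delete_iff_strongly_connected:
  assumes A: "reciprocal_mat A" and w: "w \<in> carrier_vec (dim_row A)" "positive_vec w"
    and m: "m < dim_row A"
  shows "efficient (mat_delete A m m) (vec_delete w m)
    \<longleftrightarrow> strongly_connected_on ({..<dim_row A} - {m}) (ratio_digraph A w)"
proof -
  let ?n = "dim_row A" and ?A = "mat_delete A m m" and ?w = "vec_delete w m"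
  have square: "square_mat A" using A unfolding reciprocal_mat_def by blast
  have "?w \<in> carrier_vec (dim_row ?A)" using w by (intro carrier_vecI) simp
  moreover have "positive_vec ?w" using w m by (intro positive_vec_delete) auto
  ultimately have "efficient ?A ?w
      \<longleftrightarrow> strongly_connected_on {..<?n - 1} (inv_image (ratio_digraph A w) (insert_index m))"
    using efficient_iff_strongly_connected[OF reciprocal_mat_delete[OF A m]]
      ratio_digraph_delete[OF square w(1) m] by simp
  also have "\<dots> \<longleftrightarrow> strongly_connected_on (insert_index m ` {..<?n - 1}) (ratio_digraph A w)"
    by (rule strongly_connected_on_inv_image[OF insert_index_inj_on])
  also have "insert_index m ` {..<?n - 1} = {..<?n} - {m}"
    using insert_index_image[of m "?n - 1"] m by (simp add: lessThan_atLeast0)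
  finally show ?thesis .
qed

lemma exists_efficient_delete:
  assumes A: "reciprocal_mat A" and eff: "efficient A w"
    and K: "K \<subseteq> {..<dim_row A}" "2 \<le> card K" "card ({..<dim_row A} - K) \<le> 3"
    and ones: "\<And>i j. i < dim_row A \<Longrightarrow> j < dim_row A \<Longrightarrow> i \<in> K \<or> j \<in> K \<Longrightarrow> A $$ (i, j) = 1"
  shows "\<exists>m\<in>K. efficient (mat_delete A m m) (vec_delete w m)"
proof -
  let ?P = "{..<dim_row A} - K"
  have w: "w \<in> carrier_vec (dim_row A)" "positive_vec w" using eff unfolding efficient_def by auto
  have pos: "0 < w $ i" if "i < dim_row A" for i using that w by (auto intro: positive_vecD)
  have V: "?P \<union> K = {..<dim_row A}" using K(1) by blast
  interpret comparison_digraph ?P K "ratio_digraph A w" "\<lambda>i. w $ i"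
  proof
    show "strongly_connected_on (?P \<union> K) (ratio_digraph A w)"
      unfolding V by (rule efficient_imp_strongly_connected[OF A eff])
    show "(i, j) \<in> ratio_digraph A w \<longleftrightarrow> w $ j \<le> w $ i"
      if "i \<in> ?P \<union> K" "j \<in> ?P \<union> K" "i \<in> K \<or> j \<in> K" for i j
      using that ones[of i j] pos[of j] unfolding V ratio_digraph_def by auto
    show "(i, j) \<in> ratio_digraph A w \<or> (j, i) \<in> ratio_digraph A w" if "i \<in> ?P" "j \<in> ?P" for i j
      using that by (intro ratio_digraph_semicomplete[OF A w]) auto
  qed (use K(3) in auto)
  obtain m where "m \<in> K" "strongly_connected_on ({..<dim_row A} - {m}) (ratio_digraph A w)"
    using exists_deletable_vertex[OF K(2)] unfolding V by blast
  then show ?thesis using efficient_delete_iff_strongly_connected[OF A w] K(1) by blast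
qed


section \<open>Bordering with ones\<close>

lemma index_border_ones:
  assumes "B \<in> carrier_mat k k" "i < k + m" "j < k + m"
  shows "four_block_mat B (ones_mat k m) (ones_mat m k) (ones_mat m m) $$ (i, j)
    = (if i < k \<and> j < k then B $$ (i, j) else 1)"
  using assms by (auto simp: ones_mat_def)

lemma reciprocal_border_ones:
  assumes "B \<in> carrier_mat k k" "reciprocal_mat B"
  shows "reciprocal_mat (four_block_mat B (ones_mat k m) (ones_mat m k) (ones_mat m m))"
  unfolding reciprocal_mat_def
proof (intro conjI allI impI)
  let ?A = "four_block_mat B (ones_mat k m) (ones_mat m k) (ones_mat m m)"
  have dim: "dim_row ?A = k + m" "dim_col ?A = k + m" using assms(1) by (auto simp: ones_mat_def)
  then show "square_mat ?A" by simp
  fix i j assume "i < dim_row ?A" "j < dim_row ?A"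
  then have ij: "i < k + m" "j < k + m" using dim by auto
  note index = index_border_ones[OF assms(1) ij] index_border_ones[OF assms(1) ij(2,1)]
  show "0 < ?A $$ (i, j)" "?A $$ (j, i) = 1 / ?A $$ (i, j)"
    unfolding index using reciprocal_matD[OF assms(2), of i j] assms(1) by auto
qed

theorem theorem16:
  fixes n :: nat and A B :: "real mat"
  assumes "5 \<le> n"
    and "B \<in> carrier_mat 3 3"
    and "reciprocal_mat B"
    and "A = four_block_mat B (ones_mat 3 (n - 3)) (ones_mat (n - 3) 3) (ones_mat (n - 3) (n - 3))"
  shows "efficient_vecs A = (\<Union>i\<in>{3..<n}. efficient_vecs_at A i)"
proof
  show "(\<Union>i\<in>{3..<n}. efficient_vecs_at A i) \<subseteq> efficient_vecs A"
    unfolding efficient_vecs_at_def by blast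
  have dim: "dim_row A = n" using assms(1,2) unfolding assms(4) by (auto simp: ones_mat_def)
  have A: "reciprocal_mat A" unfolding assms(4) by (rule reciprocal_border_ones[OF assms(2,3)])
  have ones: "A $$ (i, j) = 1" if "i < n" "j < n" "i \<in> {3..<n} \<or> j \<in> {3..<n}" for i j
    using that assms(1) index_border_ones[OF assms(2), of i "n - 3" j] unfolding assms(4) by auto
  have "{3..<n} \<subseteq> {..<n}" "{..<n} - {3..<n} = {..<3}" using assms(1) by auto
  then have "\<exists>m\<in>{3..<n}. efficient (mat_delete A m m) (vec_delete w m)" if "efficient A w" for w
    using exists_efficient_delete[OF A that, of "{3..<n}"] ones assms(1) unfolding dim by auto
  then show "efficient_vecs A \<subseteq> (\<Union>i\<in>{3..<n}. efficient_vecs_at A i)"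
    unfolding efficient_vecs_at_def efficient_vecs_def by blast
qed

end
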